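(* Let $\Gamma$ be a confusion graph on a finite source alphabet $\mathcal{X}$. Let $\mathcal{R}=\lim_{t\to\infty}\frac1t\log\chi(\Gamma_t)$ be the optimal zero-error compression rate with fixed-length deterministic source codes, and let $\mathcal{L}$ be the maximal leakage rate. Then $$\mathcal{L}=\mathcal{R}.$$ Moreover, any $\mathcal{R}$-achieving sequence of deterministic codes simultaneously achieves $\mathcal{L}$: if for each $t$, $P_{Y|X^t}^{(t)}$ is a valid deterministic mapping scheme (each $x^t\in\mathcal{X}^t$ is mapped to a single codeword with probability 1) with code alphabet $\mathcal{Y}_t$ and $\frac1t\log|\mathcal{Y}_t|\to\mathcal{R}$ as $t\to\infty$, then $\frac1t L^t(P^{(t)}_{Y|X^t})\to\mathcal{L}$.
   Context: Graphs are finite, simple and undirected. The confusion graph $\Gamma$ has vertex set $\mathcal{X}$, the finite alphabet of a discrete memoryless stationary source. For a positive integer $t$, $\Gamma_t=\Gamma^{\lor t}$ is the graph on $\mathcal{X}^t$ in which $x^t$ and $v^t$ are adjacent iff $\{x_j,v_j\}$ is an edge of $\Gamma$ for some $j\in\{1,\dots,t\}$. $\chi$ denotes the chromatic number; $\chi(\Gamma_t)$ is the smallest number of codewords of a valid deterministic mapping scheme for length $t$. A mapping scheme is a conditional distribution $P_{Y|X^t}$ from $\mathcal{X}^t$ to a finite code alphabet $\mathcal{Y}$ (which may be chosen freely). It is valid if for every $y\in\mathcal{Y}$ the set $\{x^t\in\mathcal{X}^t: P_{Y|X^t}(y|x^t)>0\}$ is an independent set of $\Gamma_t$. The maximal leakage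 of a valid mapping is $$L^t(P_{Y|X^t})=\log\max_{P_X}\frac{\sum_{y\in\mathcal{Y}}\max_{x^t\in\mathcal{X}^t}P_{X^t}(x^t)P_{Y|X^t}(y|x^t)}{\max_{x^t\in\mathcal{X}^t}P_{X^t}(x^t)}=\log\sum_{y\in\mathcal{Y}}\max_{x^t\in\mathcal{X}^t}P_{Y|X^t}(y|x^t),$$ where the maximum is over all distributions $P_X$ on $\mathcal{X}$ and $P_{X^t}(x^t)=\prod_j P_X(x_j)$. Put $\mathcal{L}^t=\inf L^t(P_{Y|X^t})$ over all valid mappings, and $\mathcal{L}=\lim_{t\to\infty}\frac1t\mathcal{L}^t$. The logarithm has a fixed base greater than 1. *)

theory Defs
  imports "HOL-Probability.Probability" "HOL-Library.Ramsey"
begin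

text \<open>
  Undirected graphs are given by a vertex set and a set of two-element edges. Here
  \<open>[X]\<^bsup>2\<^esup>\<close> (\<^const>\<open>nsets\<close>) is the set of two-element subsets of \<open>X\<close>, and \<^const>\<open>indep\<close>
  from the Ramsey theory is the predicate ``no two distinct elements form an edge''.
  The alphabet of a source is nonempty.
\<close>

definition confusion_graph :: "'a set \<Rightarrow> 'a set set \<Rightarrow> bool" where
  "confusion_graph X E \<longleftrightarrow> finite X \<and> X \<noteq> {} \<and> E \<subseteq> [X]\<^bsup>2\<^esup>"

definition words :: "'a set \<Rightarrow> nat \<Rightarrow> 'a list set" where
  "words X t = {xs. set xs \<subseteq> X \<and> length xs = t}"

definition or_power_edges :: "'a set \<Rightarrow> 'a set set \<Rightarrow> nat \<Rightarrow> 'a list set set" where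
  "or_power_edges X E t =
     {{xs, vs} | xs vs. xs \<in> words X t \<and> vs \<in> words X t \<and> (\<exists>j<t. {xs ! j, vs ! j} \<in> E)}"

definition proper_coloring :: "'v set \<Rightarrow> 'v set set \<Rightarrow> ('v \<Rightarrow> nat) \<Rightarrow> bool" where
  "proper_coloring V F c \<longleftrightarrow> (\<forall>u\<in>V. \<forall>v\<in>V. {u, v} \<in> F \<longrightarrow> c u \<noteq> c v)"

definition chromatic_number :: "'v set \<Rightarrow> 'v set set \<Rightarrow> nat" where
  "chromatic_number V F = (LEAST k. \<exists>c. c ` V \<subseteq> {..<k} \<and> proper_coloring V F c)"

text \<open>
  The distribution \<open>P(\<cdot> | xs)\<close> is the probability mass function \<open>K xs\<close>; the values of \<open>K\<close>
  outside \<open>words X t\<close> are never used.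
\<close>

definition mapping_scheme ::
    "'a set \<Rightarrow> nat \<Rightarrow> 'b set \<Rightarrow> ('a list \<Rightarrow> 'b pmf) \<Rightarrow> bool" where
  "mapping_scheme X t Y K \<longleftrightarrow> finite Y \<and> (\<forall>xs \<in> words X t. set_pmf (K xs) \<subseteq> Y)"

definition valid_scheme ::
    "'a set \<Rightarrow> 'a set set \<Rightarrow> nat \<Rightarrow> 'b set \<Rightarrow> ('a list \<Rightarrow> 'b pmf) \<Rightarrow> bool" where
  "valid_scheme X E t Y K \<longleftrightarrow> mapping_scheme X t Y K \<and>
     (\<forall>y\<in>Y. indep {xs \<in> words X t. pmf (K xs) y > 0} (or_power_edges X E t))"

definition deterministic_scheme ::
    "'a set \<Rightarrow> nat \<Rightarrow> 'b set \<Rightarrow> ('a list \<Rightarrow> 'b pmf) \<Rightarrow> bool" where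
  "deterministic_scheme X t Y K \<longleftrightarrow> (\<forall>xs \<in> words X t. \<exists>y\<in>Y. pmf (K xs) y = 1)"

definition memoryless_prob :: "'a pmf \<Rightarrow> 'a list \<Rightarrow> real" where
  "memoryless_prob p xs = (\<Prod>j<length xs. pmf p (xs ! j))"

definition leakage_ratio ::
    "'a set \<Rightarrow> nat \<Rightarrow> 'b set \<Rightarrow> ('a list \<Rightarrow> 'b pmf) \<Rightarrow> 'a pmf \<Rightarrow> real" where
  "leakage_ratio X t Y K p =
     (\<Sum>y\<in>Y. MAX xs \<in> words X t. memoryless_prob p xs * pmf (K xs) y) /
     (MAX xs \<in> words X t. memoryless_prob p xs)"

text \<open>
  The supremum over source distributions is attained, and the maximal leakage has a
  closed form: see \<open>leakage_ratio_max\<close> and \<open>max_leakage_eq\<close> below.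
\<close>

definition max_leakage ::
    "real \<Rightarrow> 'a set \<Rightarrow> nat \<Rightarrow> 'b set \<Rightarrow> ('a list \<Rightarrow> 'b pmf) \<Rightarrow> real" where
  "max_leakage b X t Y K = log b (SUP p \<in> {p. set_pmf p \<subseteq> X}. leakage_ratio X t Y K p)"

text \<open>
  Every finite code alphabet is in bijection with a finite set of natural numbers, so the
  infimum is taken over schemes with such alphabets.
\<close>

definition opt_leakage :: "real \<Rightarrow> 'a set \<Rightarrow> 'a set set \<Rightarrow> nat \<Rightarrow> real" where
  "opt_leakage b X E t =
     Inf {max_leakage b X t Y K | (Y :: nat set) K. valid_scheme X E t Y K}"

definition leakage_rate :: "real \<Rightarrow> 'a set \<Rightarrow> 'a set set \<Rightarrow> real" where
  "leakage_rate b X E = lim (\<lambda>t. opt_leakage b X E t / real t)"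

definition compression_rate :: "real \<Rightarrow> 'a set \<Rightarrow> 'a set set \<Rightarrow> real" where
  "compression_rate b X E =
     lim (\<lambda>t. log b (real (chromatic_number (words X t) (or_power_edges X E t))) / real t)"

lemma finite_words: "finite X \<Longrightarrow> finite (words X t)"
  unfolding words_def by (rule finite_lists_length_eq)

lemma words_nonempty: "X \<noteq> {} \<Longrightarrow> words X t \<noteq> {}"
proof -
  assume "X \<noteq> {}"
  then obtain x where "x \<in> X" by blast
  then have "replicate t x \<in> words X t" by (auto simp: words_def)
  then show ?thesis by blast
qed

lemma memoryless_prob_nonneg: "memoryless_prob p xs \<ge> 0"
  unfolding memoryless_prob_def by (intro prod_nonneg) auto

lemma Max_memoryless_prob_pos:
  assumes "finite X" "set_pmf p \<subseteq> X"
  shows "(MAX xs \<in> words X t. memoryless_prob p xs) > 0"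
proof -
  obtain x where x: "x \<in> set_pmf p" using set_pmf_not_empty[of p] by blast
  have w: "replicate t x \<in> words X t" using x assms by (auto simp: words_def)
  have "0 < memoryless_prob p (replicate t x)"
    using x by (auto simp: memoryless_prob_def pmf_positive intro!: prod_pos)
  also have "\<dots> \<le> (MAX xs \<in> words X t. memoryless_prob p xs)"
    using w finite_words[OF assms(1)] by (intro Max_ge) auto
  finally show ?thesis .
qed

lemma leakage_ratio_le:
  assumes "finite X" "set_pmf p \<subseteq> X"
  shows "leakage_ratio X t Y K p \<le> (\<Sum>y\<in>Y. MAX xs \<in> words X t. pmf (K xs) y)"
proof -
  let ?W = "words X t"
  let ?M = "MAX xs \<in> ?W. memoryless_prob p xs"
  have fin: "finite ?W" using assms(1) by (rule finite_words)
  have "X \<noteq> {}" using assms(2) set_pmf_not_empty[of p] by blast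
  then have ne: "?W \<noteq> {}" by (rule words_nonempty)
  have M: "?M > 0" using assms by (rule Max_memoryless_prob_pos)
  have "(MAX xs \<in> ?W. memoryless_prob p xs * pmf (K xs) y)
      \<le> ?M * (MAX xs \<in> ?W. pmf (K xs) y)" for y
  proof (rule Max.boundedI)
    fix a assume "a \<in> (\<lambda>xs. memoryless_prob p xs * pmf (K xs) y) ` ?W"
    then obtain xs where xs: "xs \<in> ?W" "a = memoryless_prob p xs * pmf (K xs) y" by blast
    have "memoryless_prob p xs \<le> ?M" "pmf (K xs) y \<le> (MAX xs \<in> ?W. pmf (K xs) y)"
      using xs(1) fin by (auto intro!: Max_ge)
    then show "a \<le> ?M * (MAX xs \<in> ?W. pmf (K xs) y)"
      unfolding xs(2) using M by (intro mult_mono) auto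
  qed (use fin ne in auto)
  then have "(\<Sum>y\<in>Y. MAX xs \<in> ?W. memoryless_prob p xs * pmf (K xs) y)
      \<le> ?M * (\<Sum>y\<in>Y. MAX xs \<in> ?W. pmf (K xs) y)"
    unfolding sum_distrib_left by (intro sum_mono)
  then show ?thesis
    unfolding leakage_ratio_def using M by (simp add: pos_divide_le_eq mult.commute)
qed

lemma leakage_ratio_uniform:
  assumes "finite X" "X \<noteq> {}"
  shows "leakage_ratio X t Y K (pmf_of_set X) = (\<Sum>y\<in>Y. MAX xs \<in> words X t. pmf (K xs) y)"
proof -
  let ?W = "words X t"
  define c where "c = (1 / real (card X)) ^ t"
  have fin: "finite ?W" and ne: "?W \<noteq> {}"
    using assms by (auto simp: finite_words words_nonempty)
  have c: "c > 0" using assms by (simp add: c_def card_gt_0_iff)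
  have prob: "memoryless_prob (pmf_of_set X) xs = c" if xs: "xs \<in> ?W" for xs
  proof -
    have "xs ! j \<in> X" if "j < t" for j using that xs by (auto simp: words_def)
    then have "pmf (pmf_of_set X) (xs ! j) = 1 / real (card X)" if "j < t" for j
      using that assms by simp
    then show ?thesis using xs by (simp add: memoryless_prob_def words_def c_def)
  qed
  have M: "(MAX xs \<in> ?W. memoryless_prob (pmf_of_set X) xs) = c"
    using prob ne by (simp add: image_constant_conv)
  have "(MAX xs \<in> ?W. memoryless_prob (pmf_of_set X) xs * pmf (K xs) y)
      = c * (MAX xs \<in> ?W. pmf (K xs) y)" for y
  proof -
    have "(MAX xs \<in> ?W. memoryless_prob (pmf_of_set X) xs * pmf (K xs) y)
        = Max ((\<lambda>z. c * z) ` (\<lambda>xs. pmf (K xs) y) ` ?W)"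
      by (auto simp: image_image prob intro!: arg_cong[where f = Max] image_cong)
    also have "\<dots> = c * (MAX xs \<in> ?W. pmf (K xs) y)"
      using c fin ne by (intro mono_Max_commute[symmetric] monoI) auto
    finally show ?thesis .
  qed
  then show ?thesis
    using c unfolding leakage_ratio_def M by (simp add: sum_distrib_left[symmetric])
qed

lemma leakage_ratio_max:
  assumes "finite X" "X \<noteq> {}"
  shows "\<exists>q. set_pmf q \<subseteq> X \<and>
    (\<forall>p. set_pmf p \<subseteq> X \<longrightarrow> leakage_ratio X t Y K p \<le> leakage_ratio X t Y K q)"
  using assms
  by (intro exI[of _ "pmf_of_set X"]) (simp add: leakage_ratio_uniform leakage_ratio_le)

lemma max_leakage_eq:
  assumes "finite X" "X \<noteq> {}"
  shows "max_leakage b X t Y K = log b (\<Sum>y\<in>Y. MAX xs \<in> words X t. pmf (K xs) y)"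
proof -
  have "(SUP p \<in> {p. set_pmf p \<subseteq> X}. leakage_ratio X t Y K p)
      = (\<Sum>y\<in>Y. MAX xs \<in> words X t. pmf (K xs) y)"
  proof (rule cSup_eq_maximum)
    show "(\<Sum>y\<in>Y. MAX xs \<in> words X t. pmf (K xs) y)
        \<in> leakage_ratio X t Y K ` {p. set_pmf p \<subseteq> X}"
      using assms
      by (intro image_eqI[of _ _ "pmf_of_set X"]) (auto simp: leakage_ratio_uniform)
  qed (use assms leakage_ratio_le in blast)
  then show ?thesis by (simp add: max_leakage_def)
qed

text \<open>The set whose infimum is taken in \<open>opt_leakage\<close> is nonempty and bounded below.\<close>

lemma max_leakage_nonneg:
  assumes "finite X" "X \<noteq> {}" "b > 1" "mapping_scheme X t Y K"
  shows "max_leakage b X t Y K \<ge> 0"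
proof -
  let ?W = "words X t"
  obtain ws where ws: "ws \<in> ?W" using words_nonempty[OF assms(2)] by blast
  have "1 = (\<Sum>y\<in>Y. pmf (K ws) y)"
    using assms(4) ws by (intro sum_pmf_eq_1[symmetric]) (auto simp: mapping_scheme_def)
  also have "\<dots> \<le> (\<Sum>y\<in>Y. MAX xs \<in> ?W. pmf (K xs) y)"
    using ws finite_words[OF assms(1)] by (intro sum_mono Max_ge) auto
  finally show ?thesis
    using assms by (simp add: max_leakage_eq)
qed

lemma valid_scheme_exists:
  assumes "finite X"
  shows "\<exists>(Y :: nat set) K. valid_scheme X E t Y K"
proof -
  obtain f :: "'a list \<Rightarrow> nat" where f: "inj_on f (words X t)"
    using finite_imp_inj_to_nat_seg[OF finite_words[OF assms]] by blast
  have "valid_scheme X E t (f ` words X t) (\<lambda>xs. return_pmf (f xs))"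
    using f finite_words[OF assms]
    by (auto simp: valid_scheme_def mapping_scheme_def indep_def indicator_def
        dest: inj_onD split: if_splits)
  then show ?thesis by blast
qed

end

theory Submission
  imports Defs "HOL-Real_Asymp.Real_Asymp"
begin

text \<open>
  The sets of words that may be mapped to a given codeword are independent, and weighting each
  of them with the maximal probability of its codeword gives a fractional colouring of
  \<open>\<Gamma>\<^sub>t\<close>. Hence the exponential of the leakage is at least the fractional chromatic number of
  \<open>\<Gamma>\<^sub>t\<close>, which by the greedy covering argument is at least
  \<open>\<chi>(\<Gamma>\<^sub>t) / (1 + t ln |X|)\<close>. Conversely, the leakage of a deterministic scheme is at most
  the logarithm of the size of its code alphabet, so the optimal leakage is at most
  \<open>log \<chi>(\<Gamma>\<^sub>t)\<close>. The two bounds differ by \<open>O(log t)\<close>. The limits exist by Fekete's lemma,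
  since \<open>\<chi>(\<Gamma>\<^sub>m\<^sub>+\<^sub>n) \<le> \<chi>(\<Gamma>\<^sub>m) \<chi>(\<Gamma>\<^sub>n)\<close>.
\<close>

section \<open>Fekete's lemma\<close>

lemma subadditive_mult_add_le:
  fixes a :: "nat \<Rightarrow> real"
  assumes "\<And>m n. a (m + n) \<le> a m + a n"
  shows "a (q * m + r) \<le> real q * a m + a r"
proof (induction q)
  case (Suc q)
  have "a (Suc q * m + r) \<le> a m + a (q * m + r)"
    using assms[of m "q * m + r"] by (simp add: add.assoc)
  with Suc show ?case by (simp add: algebra_simps)
qed simp

text \<open>Fix \<open>m\<close> whose quotient is close to the infimum; division of
  \<open>n\<close> by \<open>m\<close> with remainder bounds \<open>a n\<close> by
  \<open>n/m\<close> times \<open>a m\<close> plus a constant, which vanishes after division by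
  \<open>n\<close>. The infimum starts at 1 because the quotient at 0 is 0 by convention and would
  make it 0.\<close>

lemma Fekete:
  fixes a :: "nat \<Rightarrow> real"
  assumes sub: "\<And>m n. a (m + n) \<le> a m + a n" and nonneg: "\<And>n. a n \<ge> 0"
  shows "(\<lambda>n. a n / real n) \<longlonglongrightarrow> (INF n\<in>{1..}. a n / real n)"
proof (rule order_tendstoI)
  let ?I = "INF n\<in>{1..}. a n / real n"
  have bdd: "bdd_below ((\<lambda>n. a n / real n) ` {1..})"
    by (intro bdd_belowI2[of _ 0]) (simp add: nonneg)
  show "\<forall>\<^sub>F n in sequentially. l < a n / real n" if "l < ?I" for l
    using eventually_ge_at_top[of 1]
  proof eventually_elim
    case (elim n)
    then have "?I \<le> a n / real n" by (intro cINF_lower bdd) auto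
    with that show ?case by linarith
  qed
  show "\<forall>\<^sub>F n in sequentially. a n / real n < u" if "?I < u" for u
  proof -
    have "\<exists>m\<in>{1..}. a m / real m < u"
      using that by (subst (asm) cINF_less_iff[OF _ bdd]) auto
    then obtain m where m: "m \<ge> 1" "a m / real m < u" by auto
    \<comment> \<open>A bound on \<open>a\<close> at every possible remainder modulo
      \<open>m\<close>, uniform in \<open>n\<close>; it works because all summands are
      nonnegative.\<close>
    define C where "C = (\<Sum>r<m. a r)"
    have bound: "a n / real n \<le> a m / real m + C / real n" if "n \<ge> 1" for n
    proof -
      have "a n \<le> real (n div m) * a m + a (n mod m)"
        using subadditive_mult_add_le[of a "n div m" m "n mod m", OF sub] by simp
      moreover have "a (n mod m) \<le> C"
        unfolding C_def using m nonneg by (intro member_le_sum) auto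
      moreover have "real (n div m) * a m \<le> real n / real m * a m"
        by (intro mult_right_mono nonneg of_nat_div_le_of_nat)
      ultimately have "a n \<le> real n / real m * a m + C" by linarith
      then show ?thesis using that m by (simp add: field_simps)
    qed
    have "(\<lambda>n. a m / real m + C / real n) \<longlonglongrightarrow> a m / real m + 0"
      by (intro tendsto_add tendsto_const lim_const_over_n)
    then have "\<forall>\<^sub>F n in sequentially. a m / real m + C / real n < u"
      using m by (intro order_tendstoD(2)) auto
    with eventually_ge_at_top[of 1] show ?thesis
      by eventually_elim (use bound in force)
  qed
qed

section \<open>Chromatic numbers\<close>

lemma chromatic_number_le:
  assumes "c ` V \<subseteq> {..<k}" "proper_coloring V F c"
  shows "chromatic_number V F \<le> k"
  unfolding chromatic_number_def using assms by (blast intro: Least_le)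

text \<open>The minimum is attained as soon as some proper colouring exists, and an injective
  numbering of \<open>V\<close> is one. In \<open>proper_coloring\<close> the two vertices may
  coincide, so a loop \<open>{v}\<close> at a vertex would exclude every colouring.\<close>

lemma chromatic_number_coloring:
  assumes "finite V" "\<And>v. {v} \<notin> F"
  obtains c where "c ` V \<subseteq> {..<chromatic_number V F}" "proper_coloring V F c"
proof -
  obtain f n where f: "f ` V = {i::nat. i < n}" "inj_on f V"
    using finite_imp_inj_to_nat_seg[OF assms(1)] by blast
  have "proper_coloring V F f"
    using f(2) assms(2) by (auto simp: proper_coloring_def dest!: inj_onD)
  with f(1) have "\<exists>k c. c ` V \<subseteq> {..<k} \<and> proper_coloring V F c"
    by (intro exI[of _ n] exI[of _ f]) auto
  from LeastI_ex[OF this] show ?thesis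
    using that unfolding chromatic_number_def by blast
qed

lemma chromatic_number_pos:
  assumes "finite V" "V \<noteq> {}" "\<And>v. {v} \<notin> F"
  shows "chromatic_number V F \<ge> 1"
proof -
  obtain c where "c ` V \<subseteq> {..<chromatic_number V F}"
    using chromatic_number_coloring[OF assms(1,3)] by blast
  with assms(2) show ?thesis by (cases "chromatic_number V F") auto
qed

text \<open>Each vertex is coloured with the first position in \<open>ys\<close> whose set contains
  it, so every colour class lies in an independent set.\<close>

lemma chromatic_number_le_indep_cover:
  assumes "V \<subseteq> (\<Union>y\<in>set ys. S y)" "\<And>y. y \<in> set ys \<Longrightarrow> indep (S y) F" "\<And>v. {v} \<notin> F"
  shows "chromatic_number V F \<le> length ys"
proof -
  define c where "c v = (LEAST i. i < length ys \<and> v \<in> S (ys ! i))" for v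
  have c: "c v < length ys \<and> v \<in> S (ys ! c v)" if "v \<in> V" for v
  proof -
    obtain y where "y \<in> set ys" "v \<in> S y" using assms(1) \<open>v \<in> V\<close> by blast
    then have "\<exists>i. i < length ys \<and> v \<in> S (ys ! i)" by (metis in_set_conv_nth)
    from LeastI_ex[OF this] show ?thesis unfolding c_def .
  qed
  show ?thesis
  proof (rule chromatic_number_le)
    show "c ` V \<subseteq> {..<length ys}" using c by auto
    show "proper_coloring V F c"
      unfolding proper_coloring_def
    proof (intro ballI impI notI)
      fix u v assume uv: "u \<in> V" "v \<in> V" "{u, v} \<in> F" "c u = c v"
      \<comment> \<open>\<open>indep\<close> constrains distinct vertices only.\<close>
      then have "u \<noteq> v" using assms(3) by auto
      moreover have "indep (S (ys ! c u)) F" using c uv by (intro assms(2)) auto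
      ultimately show False using c[OF uv(1)] c[OF uv(2)] uv by (auto simp: indep_def)
    qed
  qed
qed

text \<open>
  Double counting shows that some \<open>S y\<close> contains at least the fraction \<open>1 / sum w Y\<close> of the
  points that are still uncovered.
\<close>

lemma greedy_cover:
  fixes w :: "'y \<Rightarrow> real" and S :: "'y \<Rightarrow> 'v set"
  assumes fin: "finite V" "finite Y" and w: "\<And>y. y \<in> Y \<Longrightarrow> w y \<ge> 0"
    and cover: "\<And>v. v \<in> V \<Longrightarrow> 1 \<le> (\<Sum>y | y \<in> Y \<and> v \<in> S y. w y)"
    and W: "sum w Y \<ge> 1"
  shows "\<exists>ys. set ys \<subseteq> Y \<and> length ys = k \<and>
    real (card (V - (\<Union>y\<in>set ys. S y))) \<le> real (card V) * (1 - 1 / sum w Y) ^ k"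
proof (induction k)
  case (Suc k)
  let ?W = "sum w Y"
  obtain ys where ys: "set ys \<subseteq> Y" "length ys = k"
    "real (card (V - (\<Union>y\<in>set ys. S y))) \<le> real (card V) * (1 - 1 / ?W) ^ k"
    using Suc by blast
  define U where "U = V - (\<Union>y\<in>set ys. S y)"
  have U: "finite U" "U \<subseteq> V" using fin by (auto simp: U_def)
  have "\<exists>y\<in>Y. real (card U) \<le> ?W * real (card (U \<inter> S y))"
  proof (rule ccontr)
    assume "\<not> ?thesis"
    then have less: "?W * real (card (U \<inter> S y)) < real (card U)" if "y \<in> Y" for y
      using that by force
    have "real (card U) = (\<Sum>v\<in>U. 1)" by simp
    also have "\<dots> \<le> (\<Sum>v\<in>U. \<Sum>y | y \<in> Y \<and> v \<in> S y. w y)"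
      using U by (intro sum_mono cover) auto
    also have "\<dots> = (\<Sum>y\<in>Y. \<Sum>v | v \<in> U \<and> v \<in> S y. w y)"
      using U fin by (intro sum.swap_restrict)
    also have "\<dots> = (\<Sum>y\<in>Y. w y * real (card (U \<inter> S y)))"
      by (simp add: Int_def mult.commute)
    finally have "?W * real (card U) \<le> (\<Sum>y\<in>Y. w y * (?W * real (card (U \<inter> S y))))"
      using W mult_left_mono[of "real (card U)" _ ?W]
      by (simp add: sum_distrib_left[symmetric] mult.left_commute[of _ ?W])
    also have "\<dots> < (\<Sum>y\<in>Y. w y * real (card U))"
    proof (rule sum_strict_mono_ex1)
      show "\<forall>y\<in>Y. w y * (?W * real (card (U \<inter> S y))) \<le> w y * real (card U)"
        by (intro ballI mult_left_mono less_imp_le[OF less] w)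
      \<comment> \<open>Strictness survives the weighting only at a positive weight; without one the
        total weight could not reach 1.\<close>
      have "\<exists>y\<in>Y. w y > 0"
        using W w sum_nonpos[of Y w] by (meson less_le_not_le not_less order_trans zero_less_one)
      then show "\<exists>y\<in>Y. w y * (?W * real (card (U \<inter> S y))) < w y * real (card U)"
        using less by (auto intro!: mult_strict_left_mono)
    qed (use fin in auto)
    also have "\<dots> = ?W * real (card U)" by (simp add: sum_distrib_right)
    finally show False by simp
  qed
  then obtain y where y: "y \<in> Y" "real (card U) \<le> ?W * real (card (U \<inter> S y))" by blast
  \<comment> \<open>The second fact makes the truncated subtraction of naturals exact.\<close>
  have "card (U - S y) = card U - card (U \<inter> S y)" "card (U \<inter> S y) \<le> card U"
    using U by (auto simp: card_Diff_subset_Int intro: card_mono)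
  then have "real (card (U - S y)) = real (card U) - real (card (U \<inter> S y))" by simp
  also have "\<dots> \<le> real (card U) * (1 - 1 / ?W)"
    using y W by (simp add: field_simps)
  also have "\<dots> \<le> real (card V) * (1 - 1 / ?W) ^ k * (1 - 1 / ?W)"
    using ys W by (intro mult_right_mono) (auto simp: U_def)
  finally have "real (card (U - S y)) \<le> real (card V) * (1 - 1 / ?W) ^ Suc k"
    by (simp add: mult_ac)
  moreover have "V - (\<Union>y\<in>set (y # ys). S y) = U - S y" by (auto simp: U_def)
  ultimately show ?case
    using y(1) ys(1,2) by (intro exI[of _ "y # ys"]) auto
qed (auto intro!: exI[of _ "[]"])

text \<open>By 1 - x \<le> exp(-x), with x the inverse of the total weight W, \<open>k\<close>
  greedy choices leave at most n exp(-k/W) of the n vertices uncovered. This is below 1 once k > W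
  ln n, and then the chosen sets are the colours.\<close>

lemma chromatic_number_le_fractional:
  fixes w :: "'y \<Rightarrow> real" and S :: "'y \<Rightarrow> 'v set"
  assumes "finite V" "V \<noteq> {}" "finite Y" and w: "\<And>y. y \<in> Y \<Longrightarrow> w y \<ge> 0"
    and cover: "\<And>v. v \<in> V \<Longrightarrow> 1 \<le> (\<Sum>y | y \<in> Y \<and> v \<in> S y. w y)"
    and indep: "\<And>y. y \<in> Y \<Longrightarrow> indep (S y) F" and loopfree: "\<And>v. {v} \<notin> F"
  shows "real (chromatic_number V F) \<le> sum w Y * (1 + ln (real (card V)))"
proof -
  let ?W = "sum w Y" and ?n = "real (card V)"
  have n: "?n \<ge> 1"
    using assms(1,2) card_gt_0_iff[of V] by linarith
  obtain v where v: "v \<in> V" using assms(2) by blast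
  have "(\<Sum>y | y \<in> Y \<and> v \<in> S y. w y) \<le> ?W"
    using assms(3) w by (intro sum_mono2) auto
  with cover[OF v] have W: "?W \<ge> 1" by linarith
  \<comment> \<open>The least integer strictly above \<open>?W * ln ?n\<close>. Strictness leaves
    fewer than one vertex, hence none; the excess of at most 1 is absorbed by
    \<open>?W \<ge> 1\<close>.\<close>
  define k where "k = nat \<lfloor>?W * ln ?n\<rfloor> + 1"
  have prod: "?W * ln ?n \<ge> 0" using W n by auto
  then have k: "?W * ln ?n < real k" "real k \<le> ?W * ln ?n + 1"
    unfolding k_def by linarith+
  obtain ys where ys: "set ys \<subseteq> Y" "length ys = k"
    "real (card (V - (\<Union>y\<in>set ys. S y))) \<le> ?n * (1 - 1 / ?W) ^ k"
    using greedy_cover[OF assms(1,3) w cover W] by blast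
  have "ln ?n < real k / ?W" using k W by (simp add: field_simps)
  have "(1 - 1 / ?W) ^ k \<le> exp (- 1 / ?W) ^ k"
    using W exp_ge_add_one_self[of "- 1 / ?W"] by (intro power_mono) auto
  also have "\<dots> = exp (- (real k / ?W))" by (simp add: exp_of_nat_mult[symmetric])
  also have "\<dots> < exp (- ln ?n)" using \<open>ln ?n < real k / ?W\<close> by simp
  also have "\<dots> = 1 / ?n" using n by (simp add: exp_minus field_simps)
  finally have "?n * (1 - 1 / ?W) ^ k < 1" using n by (simp add: field_simps)
  with ys(3) have "card (V - (\<Union>y\<in>set ys. S y)) = 0" by linarith
  then have "V \<subseteq> (\<Union>y\<in>set ys. S y)" using assms(1) by simp
  then have "chromatic_number V F \<le> k"
    using chromatic_number_le_indep_cover[of V S ys F] indep loopfree ys by auto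
  with k W show ?thesis by (simp add: algebra_simps)
qed

section \<open>Chromatic numbers of the powers of a confusion graph\<close>

text \<open>An unordered pair may match the defining pair in either order, but the adjacency
  condition is symmetric.\<close>

lemma doubleton_mem_or_power_edges:
  "{xs, vs} \<in> or_power_edges X E t \<longleftrightarrow>
     xs \<in> words X t \<and> vs \<in> words X t \<and> (\<exists>j<t. {xs ! j, vs ! j} \<in> E)"
  unfolding or_power_edges_def by (auto simp: doubleton_eq_iff insert_commute)

lemma or_power_edges_loopfree:
  assumes "confusion_graph X E"
  shows "{xs} \<notin> or_power_edges X E t"
proof -
  have "{x} \<notin> E" for x
    using assms by (auto simp: confusion_graph_def nsets_def)
  then show ?thesis
    using doubleton_mem_or_power_edges[of xs xs X E t] by simp
qed

lemma chromatic_number_power_pos: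
  assumes "confusion_graph X E"
  shows "chromatic_number (words X t) (or_power_edges X E t) \<ge> 1"
  using assms or_power_edges_loopfree[OF assms]
  by (intro chromatic_number_pos) (auto simp: confusion_graph_def finite_words words_nonempty)

text \<open>Product colouring: a word is coloured by the colours of its prefix of length
  \<open>m\<close> and its suffix of length \<open>n\<close>. Two adjacent words conflict at some
  position, so their prefixes or their suffixes are adjacent.\<close>

lemma chromatic_number_power_add_le:
  assumes "confusion_graph X E"
  shows "chromatic_number (words X (m + n)) (or_power_edges X E (m + n))
    \<le> chromatic_number (words X m) (or_power_edges X E m) *
       chromatic_number (words X n) (or_power_edges X E n)"
    (is "_ \<le> ?k * ?l")
proof -
  have fin: "finite (words X t)" for t
    using assms by (simp add: confusion_graph_def finite_words)
  obtain c where c: "c ` words X m \<subseteq> {..<?k}"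
      "proper_coloring (words X m) (or_power_edges X E m) c"
    using chromatic_number_coloring[OF fin or_power_edges_loopfree[OF assms]] by blast
  obtain d where d: "d ` words X n \<subseteq> {..<?l}"
      "proper_coloring (words X n) (or_power_edges X E n) d"
    using chromatic_number_coloring[OF fin or_power_edges_loopfree[OF assms]] by blast
  have split: "take m xs \<in> words X m" "drop m xs \<in> words X n" if "xs \<in> words X (m + n)" for xs
    using that by (auto simp: words_def dest: in_set_takeD in_set_dropD)
  have cd: "c (take m xs) < ?k" "d (drop m xs) < ?l" if "xs \<in> words X (m + n)" for xs
    using c(1) d(1) split[OF that] by auto
  \<comment> \<open>The pair of colours is encoded as one number, with the suffix colour as last
    digit in base \<open>?l\<close>; \<open>div\<close> and \<open>mod\<close> decode it.\<close>
  define f where "f xs = c (take m xs) * ?l + d (drop m xs)" for xs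
  show ?thesis
  proof (rule chromatic_number_le)
    show "f ` words X (m + n) \<subseteq> {..<?k * ?l}"
    proof
      fix z assume "z \<in> f ` words X (m + n)"
      then obtain xs where xs: "xs \<in> words X (m + n)" "z = f xs" by blast
      have "f xs < Suc (c (take m xs)) * ?l" using cd[OF xs(1)] by (simp add: f_def)
      also have "\<dots> \<le> ?k * ?l" using cd[OF xs(1)] by (intro mult_le_mono1) simp
      finally show "z \<in> {..<?k * ?l}" using xs by simp
    qed
    show "proper_coloring (words X (m + n)) (or_power_edges X E (m + n)) f"
      unfolding proper_coloring_def
    proof (intro ballI impI notI)
      fix xs vs assume xs: "xs \<in> words X (m + n)" and vs: "vs \<in> words X (m + n)"
        and e: "{xs, vs} \<in> or_power_edges X E (m + n)" and eq: "f xs = f vs"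
      have "f xs div ?l = c (take m xs)" "f vs div ?l = c (take m vs)"
           "f xs mod ?l = d (drop m xs)" "f vs mod ?l = d (drop m vs)"
        using cd[OF xs] cd[OF vs] by (simp_all add: f_def)
      with eq have ceq: "c (take m xs) = c (take m vs)" and deq: "d (drop m xs) = d (drop m vs)"
        by simp_all
      from e obtain j where j: "j < m + n" "{xs ! j, vs ! j} \<in> E"
        by (auto simp: doubleton_mem_or_power_edges)
      have len: "length xs = m + n" "length vs = m + n" using xs vs by (auto simp: words_def)
      show False
      proof (cases "j < m")
        case True
        then have "{take m xs, take m vs} \<in> or_power_edges X E m"
          using j split[OF xs] split[OF vs]
          by (auto simp: doubleton_mem_or_power_edges intro!: exI[of _ j])
        with c(2) ceq split[OF xs] split[OF vs] show False
          by (auto simp: proper_coloring_def)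
      next
        case False
        then have "{drop m xs, drop m vs} \<in> or_power_edges X E n"
          using j split[OF xs] split[OF vs] len
          by (auto simp: doubleton_mem_or_power_edges intro!: exI[of _ "j - m"])
        with d(2) deq split[OF xs] split[OF vs] show False
          by (auto simp: proper_coloring_def)
      qed
    qed
  qed
qed

section \<open>Bounds on the maximal leakage\<close>

text \<open>The probabilities of a single word already sum to 1, and the maxima dominate them. This
  keeps the arguments of the logarithms positive.\<close>

lemma sum_Max_pmf_ge_1:
  assumes "confusion_graph X E" "mapping_scheme X t Y K"
  shows "(\<Sum>y\<in>Y. MAX xs \<in> words X t. pmf (K xs) y) \<ge> 1"
proof -
  have X: "finite X" "X \<noteq> {}" using assms by (auto simp: confusion_graph_def)
  obtain ws where ws: "ws \<in> words X t" using words_nonempty[OF X(2)] by blast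
  have "1 = (\<Sum>y\<in>Y. pmf (K ws) y)"
    using assms(2) ws by (intro sum_pmf_eq_1[symmetric]) (auto simp: mapping_scheme_def)
  also have "\<dots> \<le> (\<Sum>y\<in>Y. MAX xs \<in> words X t. pmf (K xs) y)"
    using ws finite_words[OF X(1)] by (intro sum_mono Max_ge) auto
  finally show ?thesis .
qed

lemma max_leakage_le_log_card:
  assumes "confusion_graph X E" "b > 1" "mapping_scheme X t Y K"
  shows "max_leakage b X t Y K \<le> log b (real (card Y))"
proof -
  have X: "finite X" "X \<noteq> {}" using assms by (auto simp: confusion_graph_def)
  have "(\<Sum>y\<in>Y. MAX xs \<in> words X t. pmf (K xs) y) \<le> (\<Sum>y\<in>Y. 1)"
    using finite_words[OF X(1)] words_nonempty[OF X(2)]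
    by (intro sum_mono) (auto simp: pmf_le_1)
  with sum_Max_pmf_ge_1[OF assms(1,3)] show ?thesis
    unfolding max_leakage_eq[OF X] using assms(2) by (intro log_mono) auto
qed

text \<open>The supports \<open>?S\<close> with weights \<open>?w\<close> form a fractional
  colouring. Since ln |X^t| is linear in \<open>t\<close>, the price of rounding it to a colouring
  is only logarithmic in \<open>t\<close>.\<close>

lemma log_chromatic_number_le_max_leakage:
  assumes "confusion_graph X E" "b > 1" "valid_scheme X E t Y K"
  shows "log b (real (chromatic_number (words X t) (or_power_edges X E t)))
    \<le> max_leakage b X t Y K + log b (1 + real t * ln (real (card X)))"
proof -
  have X: "finite X" "X \<noteq> {}" using assms by (auto simp: confusion_graph_def)
  have map: "mapping_scheme X t Y K" using assms(3) by (simp add: valid_scheme_def)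
  then have Y: "finite Y" by (simp add: mapping_scheme_def)
  note fin = finite_words[OF X(1), of t] and ne = words_nonempty[OF X(2), of t]
  let ?w = "\<lambda>y. MAX xs \<in> words X t. pmf (K xs) y"
  let ?S = "\<lambda>y. {xs \<in> words X t. pmf (K xs) y > 0}"
  have le: "pmf (K xs) y \<le> ?w y" if "xs \<in> words X t" for xs y
    using that fin by (intro Max_ge) auto
  have "card X \<ge> 1" using X by (simp add: Suc_leI card_gt_0_iff)
  then have pos: "1 + real t * ln (real (card X)) > 0"
    by (intro add_pos_nonneg mult_nonneg_nonneg) auto
  have "real (chromatic_number (words X t) (or_power_edges X E t))
      \<le> sum ?w Y * (1 + ln (real (card (words X t))))"
  proof (rule chromatic_number_le_fractional[where S = ?S])
    show "?w y \<ge> 0" for y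
      using le ne pmf_nonneg order_trans by (metis ex_in_conv)
    show "1 \<le> (\<Sum>y | y \<in> Y \<and> xs \<in> ?S y. ?w y)" if xs: "xs \<in> words X t" for xs
    proof -
      have "1 = (\<Sum>y\<in>Y. pmf (K xs) y)"
        using map xs by (intro sum_pmf_eq_1[symmetric]) (auto simp: mapping_scheme_def)
      \<comment> \<open>The omitted codewords have probability 0 under \<open>xs\<close>.\<close>
      also have "\<dots> = (\<Sum>y | y \<in> Y \<and> xs \<in> ?S y. pmf (K xs) y)"
        using Y xs by (intro sum.mono_neutral_right) (auto simp: less_le)
      also have "\<dots> \<le> (\<Sum>y | y \<in> Y \<and> xs \<in> ?S y. ?w y)"
        using xs by (intro sum_mono le)
      finally show ?thesis .
    qed
    show "indep (?S y) (or_power_edges X E t)" if "y \<in> Y" for y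
      using assms(3) that by (simp add: valid_scheme_def)
  qed (use fin ne Y or_power_edges_loopfree[OF assms(1)] in auto)
  also have "ln (real (card (words X t))) = real t * ln (real (card X))"
    using X by (simp add: words_def card_lists_length_eq ln_realpow card_gt_0_iff)
  finally have "log b (real (chromatic_number (words X t) (or_power_edges X E t)))
      \<le> log b (sum ?w Y * (1 + real t * ln (real (card X))))"
    using assms(2) chromatic_number_power_pos[OF assms(1), of t] by (intro log_mono) auto
  also have "\<dots> = log b (sum ?w Y) + log b (1 + real t * ln (real (card X)))"
    using sum_Max_pmf_ge_1[OF assms(1) map] pos by (intro log_mult_pos) auto
  finally show ?thesis by (simp add: max_leakage_eq[OF X])
qed

text \<open>An optimal colouring is a deterministic scheme with the colours as codewords; it is
  valid because colour classes are independent.\<close>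

lemma opt_leakage_le_log_chromatic_number:
  assumes "confusion_graph X E" "b > 1"
  shows "opt_leakage b X E t
    \<le> log b (real (chromatic_number (words X t) (or_power_edges X E t)))"
proof -
  let ?k = "chromatic_number (words X t) (or_power_edges X E t)"
  have X: "finite X" "X \<noteq> {}" using assms by (auto simp: confusion_graph_def)
  obtain c where c: "c ` words X t \<subseteq> {..<?k}"
      "proper_coloring (words X t) (or_power_edges X E t) c"
    using chromatic_number_coloring[OF finite_words[OF X(1)] or_power_edges_loopfree[OF assms(1)]]
    by blast
  let ?K = "\<lambda>xs. return_pmf (c xs)"
  have map: "mapping_scheme X t {..<?k} ?K" using c(1) by (auto simp: mapping_scheme_def)
  have "valid_scheme X E t {..<?k} ?K"
    using map c(2)
    unfolding valid_scheme_def indep_def proper_coloring_def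
    by (fastforce simp: indicator_def split: if_splits)
  \<comment> \<open>The real \<open>Inf\<close> is known to be a lower bound only for sets bounded
    below.\<close>
  moreover have "bdd_below {max_leakage b X t Y K | (Y :: nat set) K. valid_scheme X E t Y K}"
    using max_leakage_nonneg[OF X assms(2)]
    by (intro bdd_belowI[of _ 0]) (auto simp: valid_scheme_def)
  ultimately have "opt_leakage b X E t \<le> max_leakage b X t {..<?k} ?K"
    unfolding opt_leakage_def by (intro cInf_lower) auto
  also have "\<dots> \<le> log b (real ?k)"
    using max_leakage_le_log_card[OF assms map] by simp
  finally show ?thesis .
qed

text \<open>The correction term is the same for all schemes, so the bound passes to the infimum over
  the nonempty set of leakages.\<close>

lemma log_chromatic_number_le_opt_leakage:
  assumes "confusion_graph X E" "b > 1"
  shows "log b (real (chromatic_number (words X t) (or_power_edges X E t)))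
    \<le> opt_leakage b X E t + log b (1 + real t * ln (real (card X)))"
proof -
  have "finite X" using assms by (auto simp: confusion_graph_def)
  then have "{max_leakage b X t Y K | (Y :: nat set) K. valid_scheme X E t Y K} \<noteq> {}"
    using valid_scheme_exists[of X E t] by blast
  then have "log b (real (chromatic_number (words X t) (or_power_edges X E t)))
      - log b (1 + real t * ln (real (card X))) \<le> opt_leakage b X E t"
    unfolding opt_leakage_def
    by (rule cInf_greatest) (use log_chromatic_number_le_max_leakage[OF assms] in force)
  then show ?thesis by simp
qed

section \<open>Asymptotic rates\<close>

text \<open>The logarithm turns submultiplicativity of the chromatic numbers into the subadditivity
  required by \<open>Fekete\<close>.\<close>

lemma convergent_log_chromatic_number:
  assumes "confusion_graph X E" "b > 1"
  shows "convergent
    (\<lambda>t. log b (real (chromatic_number (words X t) (or_power_edges X E t))) / real t)"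
proof -
  let ?chi = "\<lambda>t. chromatic_number (words X t) (or_power_edges X E t)"
  note pos = chromatic_number_power_pos[OF assms(1)]
  have "log b (real (?chi (m + n))) \<le> log b (real (?chi m)) + log b (real (?chi n))" for m n
  proof -
    have "log b (real (?chi (m + n))) \<le> log b (real (?chi m * ?chi n))"
      using assms(2) pos[of "m + n"] chromatic_number_power_add_le[OF assms(1), of m n]
      by (intro log_mono) (auto simp del: of_nat_mult)
    also have "\<dots> = log b (real (?chi m)) + log b (real (?chi n))"
      using pos[of m] pos[of n] by (simp add: log_mult_pos)
    finally show ?thesis .
  qed
  moreover have "log b (real (?chi n)) \<ge> 0" for n
    using assms(2) pos[of n] by simp
  ultimately have "(\<lambda>t. log b (real (?chi t)) / real t)
      \<longlonglongrightarrow> (INF t\<in>{1..}. log b (real (?chi t)) / real t)"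
    by (rule Fekete)
  then show ?thesis by (rule convergentI)
qed

lemma log_linear_over_n_tendsto_0:
  fixes b c :: real
  assumes "b > 1" "c \<ge> 0"
  shows "(\<lambda>n. log b (1 + real n * c) / real n) \<longlonglongrightarrow> 0"
\<comment> \<open>With \<open>c\<close> the logarithm of the alphabet size, the value 0 belongs to a
  one-letter alphabet; the sequence is then constantly 0.\<close>
proof (cases "c = 0")
  case False
  with assms(2) have "c > 0" by simp
  then have "(\<lambda>n. ln (1 + real n * c) / real n / ln b) \<longlonglongrightarrow> 0 / ln b"
  proof (intro tendsto_divide tendsto_const)
    show "(\<lambda>n. ln (1 + real n * c) / real n) \<longlonglongrightarrow> 0" using \<open>c > 0\<close> by real_asymp
  qed (use assms(1) in auto)
  then show ?thesis by (simp add: log_def mult.commute)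
qed simp

theorem mainTheorem3:
  fixes X :: "'a set" and E :: "'a set set" and b :: real
  assumes "confusion_graph X E" and "b > 1"
  shows "(\<lambda>t. log b (real (chromatic_number (words X t) (or_power_edges X E t))) / real t)
           \<longlonglongrightarrow> compression_rate b X E
       \<and> (\<lambda>t. opt_leakage b X E t / real t) \<longlonglongrightarrow> leakage_rate b X E
       \<and> leakage_rate b X E = compression_rate b X E
       \<and> (\<forall>(Y :: nat \<Rightarrow> 'b set) (K :: nat \<Rightarrow> 'a list \<Rightarrow> 'b pmf).
            (\<forall>t\<ge>1. valid_scheme X E t (Y t) (K t) \<and> deterministic_scheme X t (Y t) (K t)) \<and>
            (\<lambda>t. log b (real (card (Y t))) / real t) \<longlonglongrightarrow> compression_rate b X E
            \<longrightarrow> (\<lambda>t. max_leakage b X t (Y t) (K t) / real t) \<longlonglongrightarrow> leakage_rate b X E)"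
proof -
  let ?R = "compression_rate b X E"
  let ?a = "\<lambda>t. log b (real (chromatic_number (words X t) (or_power_edges X E t)))"
  let ?e = "\<lambda>t. log b (1 + real t * ln (real (card X)))"
  have a: "(\<lambda>t. ?a t / real t) \<longlonglongrightarrow> ?R"
    unfolding compression_rate_def
    using convergent_log_chromatic_number[OF assms] by (simp add: convergent_LIMSEQ_iff)
  have "card X \<ge> 1"
    using assms(1) by (auto simp: confusion_graph_def Suc_leI card_gt_0_iff)
  then have "(\<lambda>t. ?e t / real t) \<longlonglongrightarrow> 0"
    using assms(2) by (intro log_linear_over_n_tendsto_0) auto
  \<comment> \<open>One lower bound for both sandwiches below: for the optimal leakage and for the
    leakage of a given code sequence.\<close>
  from tendsto_diff[OF a this] have lower: "(\<lambda>t. (?a t - ?e t) / real t) \<longlonglongrightarrow> ?R"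
    by (simp add: diff_divide_distrib)
  have opt: "(\<lambda>t. opt_leakage b X E t / real t) \<longlonglongrightarrow> ?R"
  proof (rule tendsto_sandwich[OF _ _ lower a])
    show "\<forall>\<^sub>F t in sequentially. (?a t - ?e t) / real t \<le> opt_leakage b X E t / real t"
      using log_chromatic_number_le_opt_leakage[OF assms]
      by (intro always_eventually allI divide_right_mono) (auto simp: diff_le_eq)
    show "\<forall>\<^sub>F t in sequentially. opt_leakage b X E t / real t \<le> ?a t / real t"
      using opt_leakage_le_log_chromatic_number[OF assms]
      by (intro always_eventually allI divide_right_mono) auto
  qed
  then have rate: "leakage_rate b X E = ?R"
    unfolding leakage_rate_def by (rule limI)
  \<comment> \<open>The upper side of this sandwich is the rate of the code itself, which tends to
    \<open>?R\<close> by assumption. The schemes are constrained from length 1 on, so the bounds are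
    shown eventually.\<close>
  have "(\<lambda>t. max_leakage b X t (Y t) (K t) / real t) \<longlonglongrightarrow> ?R"
    if valid: "\<forall>t\<ge>1. valid_scheme X E t (Y t) (K t)"
      and Y: "(\<lambda>t. log b (real (card (Y t))) / real t) \<longlonglongrightarrow> ?R"
    for Y :: "nat \<Rightarrow> 'b set" and K
  proof (rule tendsto_sandwich[OF _ _ lower Y])
    show "\<forall>\<^sub>F t in sequentially. (?a t - ?e t) / real t \<le> max_leakage b X t (Y t) (K t) / real t"
      using eventually_ge_at_top[of 1]
    proof eventually_elim
      case (elim t)
      with valid log_chromatic_number_le_max_leakage[OF assms, of t "Y t" "K t"]
      show ?case by (intro divide_right_mono) (auto simp: diff_le_eq)
    qed
    show "\<forall>\<^sub>F t in sequentially.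
        max_leakage b X t (Y t) (K t) / real t \<le> log b (real (card (Y t))) / real t"
      using eventually_ge_at_top[of 1]
    proof eventually_elim
      case (elim t)
      with valid max_leakage_le_log_card[OF assms, of t "Y t" "K t"]
      show ?case by (intro divide_right_mono) (auto simp: valid_scheme_def)
    qed
  qed
  with a opt rate show ?thesis by simp
qed

end
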